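(* Let $A$ be a commutative approximately unital Banach algebra. The closed ideals in $A$ having a bounded approximate identity in ${\mathfrak r}_A$ (respectively, in ${\mathfrak F}_A$) are precisely the ideals of the form $\overline{EA}$ for some subset $E\subset{\mathfrak F}_A$ (respectively, $E\subset{\mathfrak r}_A$). They are also precisely the closures of unions of increasing (upward directed) families of ideals of the form $\overline{xA}$ with $x\in{\mathfrak F}_A$ (respectively, $x\in{\mathfrak r}_A$).
   Context: Banach algebras are complex with submultiplicative norm; "unital" means identity of norm 1. Approximately unital: has a contractive approximate identity. Multiplier unitization $A^1$: $A$ if unital, otherwise $A+\mathbb{C}1$ with $\|a+\lambda1\|=\sup\{\|ac+\lambda c\|:c\in A,\|c\|\le1\}$. ${\mathfrak F}_A=\{a\in A:\|1-a\|_{A^1}\le1\}$; ${\mathfrak r}_A=\{a\in A:\mathrm{Re}\,\varphi(a)\ge0$ for all $\varphi\in(A^1)^*$ with $\|\varphi\|=\varphi(1)=1\}$. A bounded approximate identity (bai) is a bounded net $(e_t)$ with $e_ta\to a$ for all $a$ in the ideal. $\overline{EA}$ denotes the closed linear span of $\{xa:x\in E,a\in A\}$. *)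

theory Defs
  imports "HOL-Analysis.Analysis"
begin

text \<open>A (possibly non-unital) commutative Banach algebra is modelled by a type
  'a of class real_normed_algebra, comm_ring, banach, together with a complex
  scalar multiplication cs extending the real one and compatible with norm and
  product.\<close>

definition complex_scaling :: "(complex \<Rightarrow> 'a::{real_normed_algebra,comm_ring} \<Rightarrow> 'a) \<Rightarrow> bool" where
  "complex_scaling cs \<longleftrightarrow>
     (\<forall>c a b. cs c (a + b) = cs c a + cs c b) \<and>
     (\<forall>c d a. cs (c + d) a = cs c a + cs d a) \<and>
     (\<forall>c d a. cs (c * d) a = cs c (cs d a)) \<and>
     (\<forall>r a. cs (complex_of_real r) a = scaleR r a) \<and>
     (\<forall>c a. norm (cs c a) = cmod c * norm a) \<and>
     (\<forall>c a b. cs c (a * b) = cs c a * b) \<and>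
     (\<forall>c a b. cs c (a * b) = a * cs c b)"

text \<open>Norm of a + \<lambda>1 in the multiplier unitization A^1 (pairs (a,\<lambda>)).
  When A is unital with identity e of norm 1 this equals norm (a + \<lambda> e),
  so it also covers the case A^1 = A.\<close>
definition unit_norm :: "(complex \<Rightarrow> 'a::{real_normed_algebra,comm_ring} \<Rightarrow> 'a) \<Rightarrow> 'a \<Rightarrow> complex \<Rightarrow> real" where
  "unit_norm cs a l = Sup {norm (a * c + cs l c) | c. norm c \<le> 1}"

text \<open>States of A^1: functionals \<phi>(a + \<lambda>1) = f a + \<lambda> with f complex linear on A,
  \<phi>(1) = 1 and norm of \<phi> at most 1.\<close>
definition unit_state :: "(complex \<Rightarrow> 'a::{real_normed_algebra,comm_ring} \<Rightarrow> 'a) \<Rightarrow> ('a \<Rightarrow> complex) \<Rightarrow> bool" where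
  "unit_state cs f \<longleftrightarrow>
     (\<forall>a b. f (a + b) = f a + f b) \<and> (\<forall>c a. f (cs c a) = c * f a) \<and>
     (\<forall>a l. cmod (f a + l) \<le> unit_norm cs a l)"

definition frakF :: "(complex \<Rightarrow> 'a::{real_normed_algebra,comm_ring} \<Rightarrow> 'a) \<Rightarrow> 'a set" where
  "frakF cs = {a. unit_norm cs (- a) 1 \<le> 1}"

definition frakr :: "(complex \<Rightarrow> 'a::{real_normed_algebra,comm_ring} \<Rightarrow> 'a) \<Rightarrow> 'a set" where
  "frakr cs = {a. \<forall>f. unit_state cs f \<longrightarrow> Re (f a) \<ge> 0}"

text \<open>Nets are represented by (proper) filters on 'a (the image filter of the net).\<close>
definition approx_unital :: "'a::{real_normed_algebra,comm_ring} itself \<Rightarrow> bool" where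
  "approx_unital _ \<longleftrightarrow> (\<exists>F :: 'a filter. F \<noteq> bot \<and> (\<forall>\<^sub>F e in F. norm e \<le> 1) \<and>
       (\<forall>a::'a. ((\<lambda>e. e * a) \<longlongrightarrow> a) F))"

definition is_ideal :: "(complex \<Rightarrow> 'a::{real_normed_algebra,comm_ring} \<Rightarrow> 'a) \<Rightarrow> 'a set \<Rightarrow> bool" where
  "is_ideal cs J \<longleftrightarrow> 0 \<in> J \<and> (\<forall>a\<in>J. \<forall>b\<in>J. a + b \<in> J) \<and> (\<forall>c. \<forall>a\<in>J. cs c a \<in> J) \<and>
     (\<forall>a\<in>J. \<forall>b. a * b \<in> J)"

definition has_bai_in :: "'a::{real_normed_algebra,comm_ring} set \<Rightarrow> 'a set \<Rightarrow> bool" where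
  "has_bai_in J S \<longleftrightarrow> (\<exists>F :: 'a filter. \<exists>M. F \<noteq> bot \<and>
       (\<forall>\<^sub>F e in F. e \<in> J \<and> e \<in> S \<and> norm e \<le> M) \<and>
       (\<forall>a\<in>J. ((\<lambda>e. e * a) \<longlongrightarrow> a) F))"

definition complex_subspace :: "(complex \<Rightarrow> 'a::{real_normed_algebra,comm_ring} \<Rightarrow> 'a) \<Rightarrow> 'a set \<Rightarrow> bool" where
  "complex_subspace cs V \<longleftrightarrow> 0 \<in> V \<and> (\<forall>a\<in>V. \<forall>b\<in>V. a + b \<in> V) \<and> (\<forall>c. \<forall>a\<in>V. cs c a \<in> V)"

definition cspan :: "(complex \<Rightarrow> 'a::{real_normed_algebra,comm_ring} \<Rightarrow> 'a) \<Rightarrow> 'a set \<Rightarrow> 'a set" where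
  "cspan cs S = \<Inter>{V. complex_subspace cs V \<and> S \<subseteq> V}"

definition closedEA :: "(complex \<Rightarrow> 'a::{real_normed_algebra,comm_ring} \<Rightarrow> 'a) \<Rightarrow> 'a set \<Rightarrow> 'a set" where
  "closedEA cs E = closure (cspan cs {x * a | x a. x \<in> E})"

definition directed_union_form :: "(complex \<Rightarrow> 'a::{real_normed_algebra,comm_ring} \<Rightarrow> 'a) \<Rightarrow> 'a set \<Rightarrow> 'a set \<Rightarrow> bool" where
  "directed_union_form cs S J \<longleftrightarrow> (\<exists>\<J> :: 'a set set. \<J> \<noteq> {} \<and>
       (\<forall>I\<in>\<J>. \<exists>x\<in>S. I = closedEA cs {x}) \<and>
       (\<forall>I1\<in>\<J>. \<forall>I2\<in>\<J>. \<exists>I3\<in>\<J>. I1 \<union> I2 \<subseteq> I3) \<and>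
       J = closure (\<Union>\<J>))"

end

theory Submission
  imports Defs
begin

text \<open>In the unitization, x belongs to F iff multiplication by 1 - x is a contraction. Norming
  functionals give norm z \<le> norm (z + x * z) for x in r, so for small s > 0 the element
  y = sx(1 + sx)^(-1) lies in F and yA = xA; this reduces r to F.
  For x in F put h = x/2. Then 1 - h is the average of the identity and the contraction 1 - x, hence
  (1 - h)^n x \<rightarrow> 0 pointwise on A, and 1 - (1 - h)^n is an approximate identity in F for the closure
  of xA. The identity 1 - (e + f - ef) = (1 - e)(1 - f) combines finitely many of these into one
  approximate identity for the closure of EA, and the element h + k - hk with h = x/2 and k = y/2
  generates an ideal containing both x and y, which yields directedness.\<close>

section \<open>Norming functionals\<close>

text \<open>Homogeneity is demanded only as an inequality, the form that is easy to check for
  infima. Equality follows by applying it to \<open>1 / r\<close> as well.\<close>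

definition sublinear_functional :: "('a::real_vector \<Rightarrow> real) \<Rightarrow> bool" where
  "sublinear_functional p \<longleftrightarrow>
     (\<forall>a b. p (a + b) \<le> p a + p b) \<and> (\<forall>r a. 0 \<le> r \<longrightarrow> p (r *\<^sub>R a) \<le> r * p a)"

lemma sublinear_functionalI:
  assumes "\<And>a b. p (a + b) \<le> p a + p b" and "\<And>r a. 0 \<le> r \<Longrightarrow> p (r *\<^sub>R a) \<le> r * p a"
  shows "sublinear_functional p"
  using assms by (auto simp: sublinear_functional_def)

lemma sublinear_functional_add: "sublinear_functional p \<Longrightarrow> p (a + b) \<le> p a + p b"
  by (simp add: sublinear_functional_def)

lemma sublinear_functional_scaleR_le:
  "sublinear_functional p \<Longrightarrow> 0 \<le> r \<Longrightarrow> p (r *\<^sub>R a) \<le> r * p a"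
  by (simp add: sublinear_functional_def)

lemma sublinear_functional_zero:
  assumes "sublinear_functional p"
  shows "p 0 = 0"
  using sublinear_functional_add[OF assms, of 0 0] sublinear_functional_scaleR_le[OF assms, of 0 0]
  by simp

lemma sublinear_functional_scaleR:
  assumes p: "sublinear_functional p" and r: "0 \<le> r"
  shows "p (r *\<^sub>R a) = r * p a"
proof (cases "r = 0")
  case True
  then show ?thesis using sublinear_functional_zero[OF p] by simp
next
  case False
  then have "p a \<le> (1 / r) * p (r *\<^sub>R a)"
    using sublinear_functional_scaleR_le[OF p, of "1 / r" "r *\<^sub>R a"] r by simp
  then have "r * p a \<le> p (r *\<^sub>R a)"
    using False r by (simp add: field_simps)
  then show ?thesis
    using sublinear_functional_scaleR_le[OF p r] by (simp add: antisym)
qed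

lemma sublinear_functional_minus:
  assumes "sublinear_functional p"
  shows "- p (- a) \<le> p a"
  using sublinear_functional_add[OF assms, of a "- a"] sublinear_functional_zero[OF assms] by simp

text \<open>Lowering p along a direction w; minimal functionals are unchanged, which forces additivity.\<close>

definition lower_along :: "('a::real_vector \<Rightarrow> real) \<Rightarrow> 'a \<Rightarrow> 'a \<Rightarrow> real" where
  "lower_along p w a = (INF t\<in>{0..}. p (a + t *\<^sub>R w) - t * p w)"

text \<open>Subadditivity at \<open>s w = (a + s w) + (- a)\<close> bounds every term below by
  \<open>- p (- a)\<close>, so the infimum is a genuine one.\<close>

lemma lower_along_le:
  assumes p: "sublinear_functional p" and "0 \<le> t"
  shows "lower_along p w a \<le> p (a + t *\<^sub>R w) - t * p w"
proof -
  have "- p (- a) \<le> p (a + s *\<^sub>R w) - s * p w" if "0 \<le> s" for s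
    using sublinear_functional_add[OF p, of "a + s *\<^sub>R w" "- a"]
      sublinear_functional_scaleR[OF p that, of w] by simp
  then have "bdd_below ((\<lambda>t. p (a + t *\<^sub>R w) - t * p w) ` {0..})"
    by (intro bdd_belowI[of _ "- p (- a)"]) auto
  then show ?thesis
    unfolding lower_along_def using assms(2) by (intro cINF_lower) auto
qed

lemma lower_along_greatest:
  assumes "\<And>t. 0 \<le> t \<Longrightarrow> m \<le> p (a + t *\<^sub>R w) - t * p w"
  shows "m \<le> lower_along p w a"
  unfolding lower_along_def using assms by (intro cINF_greatest) auto

text \<open>Shifts add: parameter \<open>s\<close> for \<open>a\<close> and \<open>t\<close> for
  \<open>b\<close> give the admissible parameter \<open>s + t\<close> for \<open>a + b\<close>. For
  scaling by \<open>r\<close>, the parameter \<open>t\<close> is replaced by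
  \<open>r * t\<close>.\<close>

lemma sublinear_functional_lower_along:
  assumes p: "sublinear_functional p"
  shows "sublinear_functional (lower_along p w)"
proof (rule sublinear_functionalI)
  fix a b
  have *: "lower_along p w (a + b) \<le> (p (a + s *\<^sub>R w) - s * p w) + (p (b + t *\<^sub>R w) - t * p w)"
    if "0 \<le> s" "0 \<le> t" for s t
  proof -
    have "lower_along p w (a + b) \<le> p ((a + b) + (s + t) *\<^sub>R w) - (s + t) * p w"
      using that by (intro lower_along_le[OF p]) auto
    also have "(a + b) + (s + t) *\<^sub>R w = (a + s *\<^sub>R w) + (b + t *\<^sub>R w)"
      by (simp add: algebra_simps)
    finally show ?thesis
      using sublinear_functional_add[OF p, of "a + s *\<^sub>R w" "b + t *\<^sub>R w"]
      by (simp add: algebra_simps)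
  qed
  have "lower_along p w (a + b) - (p (a + s *\<^sub>R w) - s * p w) \<le> lower_along p w b"
    if "0 \<le> s" for s
    using *[OF that] by (intro lower_along_greatest) (simp add: algebra_simps)
  then have "lower_along p w (a + b) - lower_along p w b \<le> lower_along p w a"
    by (intro lower_along_greatest) (simp add: algebra_simps)
  then show "lower_along p w (a + b) \<le> lower_along p w a + lower_along p w b" by simp
next
  fix r :: real and a
  assume r: "0 \<le> r"
  show "lower_along p w (r *\<^sub>R a) \<le> r * lower_along p w a"
  proof (cases "r = 0")
    case True
    then show ?thesis
      using lower_along_le[OF p, of 0 w 0] sublinear_functional_zero[OF p] by simp
  next
    case False
    with r have r0: "0 < r" by simp
    have "lower_along p w (r *\<^sub>R a) / r \<le> p (a + t *\<^sub>R w) - t * p w" if "0 \<le> t" for t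
    proof -
      have "lower_along p w (r *\<^sub>R a) \<le> p (r *\<^sub>R a + (r * t) *\<^sub>R w) - (r * t) * p w"
        using that r by (intro lower_along_le[OF p]) auto
      also have "r *\<^sub>R a + (r * t) *\<^sub>R w = r *\<^sub>R (a + t *\<^sub>R w)"
        by (simp add: algebra_simps)
      also have "p \<dots> - (r * t) * p w = r * (p (a + t *\<^sub>R w) - t * p w)"
        by (simp add: sublinear_functional_scaleR[OF p r] right_diff_distrib)
      finally show ?thesis using r0 by (simp add: divide_le_eq mult.commute)
    qed
    then have "lower_along p w (r *\<^sub>R a) / r \<le> lower_along p w a"
      by (rule lower_along_greatest)
    then show ?thesis using r0 by (simp add: divide_le_eq mult.commute)
  qed
qed

text \<open>The parameter 0 shows that lowering stays below \<open>p\<close>, so minimality makes it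
  equal to \<open>p\<close>. The parameter 1 then reads \<open>p a <= p (a + w) - p w\<close>, the
  converse of subadditivity.\<close>

lemma minimal_sublinear_functional_linear:
  assumes p: "sublinear_functional p"
    and min: "\<And>q. sublinear_functional q \<Longrightarrow> (\<And>a. q a \<le> p a) \<Longrightarrow> q = p"
  shows "linear p"
proof -
  have lower: "lower_along p w = p" for w
  proof (rule min[OF sublinear_functional_lower_along[OF p]])
    show "lower_along p w a \<le> p a" for a
      using lower_along_le[OF p, of 0 w a] by simp
  qed
  have add: "p (a + w) = p a + p w" for a w
    using lower_along_le[OF p, of 1 w a] sublinear_functional_add[OF p, of a w]
    unfolding lower by simp
  have minus: "p (- a) = - p a" for a
    using add[of a "- a"] sublinear_functional_zero[OF p] by simp
  have scale: "p (r *\<^sub>R a) = r * p a" for r a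
    using sublinear_functional_scaleR[OF p, of r a] sublinear_functional_scaleR[OF p, of "- r" a]
      minus[of "r *\<^sub>R a"]
    by (cases "0 \<le> r") auto
  show ?thesis
    by (rule linearI) (simp_all add: add scale)
qed

lemma exists_linear_below_sublinear:
  assumes p: "sublinear_functional p"
  shows "\<exists>u. linear u \<and> (\<forall>a. u a \<le> p a)"
proof -
  define S where "S = {q. sublinear_functional q \<and> (\<forall>a. q a \<le> p a)}"
  \<comment> \<open>The order is reversed, so that the maximal element supplied by Zorn's lemma is a
    minimal functional. The bound of a chain is its pointwise infimum.\<close>
  define P where "P = (\<lambda>f g :: 'a \<Rightarrow> real. \<forall>a. g a \<le> f a)"
  have "\<exists>m\<in>S. \<forall>q\<in>S. P m q \<longrightarrow> q = m"
  proof (rule predicate_Zorn)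
    show "partial_order_on S (relation_of P S)"
      by (rule partial_order_on_relation_ofI) (auto simp: P_def fun_eq_iff intro: order_trans antisym)
    fix C
    assume C: "C \<in> Chains (relation_of P S)"
    then have CS: "C \<subseteq> S" and tot: "\<And>f g. f \<in> C \<Longrightarrow> g \<in> C \<Longrightarrow> P f g \<or> P g f"
      by (auto simp: Chains_def relation_of_def)
    show "\<exists>u\<in>S. \<forall>q\<in>C. P q u"
    proof (cases "C = {}")
      case True
      then show ?thesis using p by (auto simp: S_def)
    next
      case False
      define u where "u = (\<lambda>a. INF q\<in>C. q a)"
      have sub: "sublinear_functional q" and le: "q a \<le> p a" if "q \<in> C" for q a
        using that CS by (auto simp: S_def)
      have "- p (- a) \<le> q a" if "q \<in> C" for q a
        using sublinear_functional_minus[OF sub[OF that], of a] le[OF that, of "- a"] by simp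
      then have bdd: "bdd_below ((\<lambda>q. q a) ` C)" for a
        by (intro bdd_belowI[of _ "- p (- a)"]) auto
      have lower: "u a \<le> q a" if "q \<in> C" for q a
        unfolding u_def using bdd that by (rule cINF_lower)
      have greatest: "m \<le> u a" if "\<And>q. q \<in> C \<Longrightarrow> m \<le> q a" for m a
        unfolding u_def using False that by (rule cINF_greatest)
      have "sublinear_functional u"
      proof (rule sublinear_functionalI)
        fix a b
        \<comment> \<open>The chain property enters here: the smaller of \<open>f\<close> and
          \<open>g\<close> serves as \<open>h\<close> at both points.\<close>
        have *: "u (a + b) \<le> f a + g b" if fg: "f \<in> C" "g \<in> C" for f g
        proof -
          from tot[OF fg] obtain h where h: "h \<in> C" "h a \<le> f a" "h b \<le> g b"
            using fg by (auto simp: P_def)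
          then show ?thesis
            using lower[OF h(1), of "a + b"] sublinear_functional_add[OF sub[OF h(1)], of a b] by simp
        qed
        have "u (a + b) - f a \<le> u b" if "f \<in> C" for f
          using *[OF that] by (intro greatest) (simp add: algebra_simps)
        then have "u (a + b) - u b \<le> u a"
          by (intro greatest) (simp add: algebra_simps)
        then show "u (a + b) \<le> u a + u b" by simp
      next
        fix r :: real and a
        assume r: "0 \<le> r"
        have *: "u (r *\<^sub>R a) \<le> r * q a" if "q \<in> C" for q
          using lower[OF that, of "r *\<^sub>R a"] sublinear_functional_scaleR[OF sub[OF that] r, of a] by simp
        show "u (r *\<^sub>R a) \<le> r * u a"
        proof (cases "r = 0")
          case True
          then show ?thesis using * False by auto
        next
          case r0: False
          with r have "u (r *\<^sub>R a) / r \<le> u a"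
            using * by (intro greatest) (simp add: divide_le_eq mult.commute)
          with r r0 show ?thesis by (simp add: divide_le_eq mult.commute)
        qed
      qed
      moreover have "u a \<le> p a" for a
        using False lower le by (meson all_not_in_conv order_trans)
      ultimately show ?thesis
        using lower by (intro bexI[of _ u]) (auto simp: S_def P_def)
    qed
  qed
  then obtain m where m: "m \<in> S" and min: "\<And>q. q \<in> S \<Longrightarrow> P m q \<Longrightarrow> q = m" by blast
  have "linear m"
  proof (rule minimal_sublinear_functional_linear)
    show "sublinear_functional m" using m by (simp add: S_def)
    fix q
    assume "sublinear_functional q" and "\<And>a. q a \<le> m a"
    then show "q = m"
      using m by (intro min) (auto simp: S_def P_def intro: order_trans)
  qed
  then show ?thesis using m by (auto simp: S_def)
qed

text \<open>Lowering the norm along \<open>z\<close> with parameter 1 gives at most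
  \<open>norm 0 - norm z\<close> at \<open>- z\<close>. A linear functional below it therefore
  satisfies \<open>u z >= norm z\<close>.\<close>

lemma exists_real_norming_functional:
  fixes z :: "'a::real_normed_vector"
  shows "\<exists>u. linear u \<and> (\<forall>a. u a \<le> norm a) \<and> u z = norm z"
proof -
  have norm: "sublinear_functional (norm :: 'a \<Rightarrow> real)"
    by (rule sublinear_functionalI) (auto intro: norm_triangle_ineq)
  obtain u where u: "linear u" "\<And>a. u a \<le> lower_along norm z a"
    using exists_linear_below_sublinear[OF sublinear_functional_lower_along[OF norm]] by blast
  have le: "u a \<le> norm a" for a
    using u(2)[of a] lower_along_le[OF norm, of 0 z a] by simp
  have "- u z \<le> - norm z"
    using u(2)[of "- z"] lower_along_le[OF norm, of 1 z "- z"] linear_neg[OF u(1), of z] by simp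
  with le[of z] have "u z = norm z" by simp
  with u(1) le show ?thesis by blast
qed

section \<open>Powers of averaged contractions\<close>

text \<open>The constant is the sum over \<open>j <= m\<close> of (m choose j) - 1, the excess of
  the binomial coefficients of (1 + T)^m over those of the plain sum. The induction avoids the
  coefficients: each step doubles the error and adds at most \<open>m * norm v\<close>.\<close>

lemma one_plus_contraction_power:
  fixes T :: "'a::real_normed_vector \<Rightarrow> 'a"
  assumes T: "linear T" and contr: "\<And>z. norm (T z) \<le> norm z"
  shows "norm (((\<lambda>z. z + T z) ^^ m) v - (\<Sum>j\<le>m. (T ^^ j) v)) \<le> (2 ^ m - real m - 1) * norm v"
proof (induction m)
  case 0
  then show ?case by simp
next
  case (Suc m)
  define r where "r = ((\<lambda>z. z + T z) ^^ m) v - (\<Sum>j\<le>m. (T ^^ j) v)"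
  define s where "s = (\<Sum>j\<in>{1..m}. (T ^^ j) v)"
  have pow: "norm ((T ^^ j) v) \<le> norm v" for j
    by (induction j) (auto intro: order_trans[OF contr])
  have sum0: "(\<Sum>j\<le>m. (T ^^ j) v) = v + s"
    unfolding s_def by (simp add: sum.atMost_shift sum.atLeast1_atMost_eq)
  have sumT: "T (\<Sum>j\<le>m. (T ^^ j) v) = s + (T ^^ Suc m) v"
    unfolding s_def by (simp add: linear_sum[OF T] linear_add[OF T] sum.atLeast1_atMost_eq lessThan_Suc_atMost[symmetric])
  \<comment> \<open>Applying 1 + T to the sum of powers produces the middle terms \<open>s\<close>
    twice; one copy is left over.\<close>
  have "((\<lambda>z. z + T z) ^^ Suc m) v - (\<Sum>j\<le>Suc m. (T ^^ j) v) = r + T r + s"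
    using sumT by (simp add: r_def linear_diff[OF T] sum0)
  moreover have "norm s \<le> (\<Sum>j\<in>{1..m}. norm v)"
    unfolding s_def by (rule sum_norm_le) (rule pow)
  then have "norm s \<le> real m * norm v" by simp
  moreover have "norm (r + T r + s) \<le> norm r + norm (T r) + norm s"
    by (metis (no_types, opaque_lifting) add_right_mono norm_triangle_ineq order_trans)
  moreover have "norm r \<le> (2 ^ m - real m - 1) * norm v"
    using Suc.IH by (simp add: r_def)
  ultimately show ?case
    using contr[of r] by (simp add: algebra_simps)
qed

text \<open>The norms of \<open>v n\<close> decrease to some \<open>\<delta>\<close>. Up to the
  error of the previous lemma, \<open>2 ^ m\<close> times \<open>v (m + n)\<close> is the sum of the
  \<open>(T ^^ j) (v n)\<close>, which telescopes because \<open>v n\<close> lies in the range of 1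
  - T and is bounded by \<open>2 * norm w\<close> for every m. Letting n tend to infinity gives
  \<open>(m + 1) * \<delta> <= 2 * norm w\<close> for all m, so \<open>\<delta>\<close>
  vanishes.\<close>

lemma averaged_contraction_power_tendsto_zero:
  fixes T :: "'a::real_normed_vector \<Rightarrow> 'a"
  assumes T: "linear T" and contr: "\<And>z. norm (T z) \<le> norm z"
  defines "L \<equiv> \<lambda>z. (1/2) *\<^sub>R (z + T z)"
  shows "(\<lambda>n. (L ^^ n) (w - T w)) \<longlonglongrightarrow> 0"
proof -
  have L: "linear L"
    unfolding L_def by (rule linearI)
      (simp_all add: linear_add[OF T] linear_scale[OF T] algebra_simps)
  have contrL: "norm (L z) \<le> norm z" for z
    using norm_triangle_ineq[of z "T z"] contr[of z] by (simp add: L_def)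
  have LT: "L (T z) = T (L z)" for z
    by (simp add: L_def linear_add[OF T] linear_scale[OF T])
  have powL: "norm ((L ^^ n) z) \<le> norm z" for n z
    by (induction n) (auto intro: order_trans[OF contrL])
  have powLT: "(L ^^ n) (T z) = T ((L ^^ n) z)" for n z
    by (induction n) (auto simp: LT)
  have powLdiff: "(L ^^ n) (a - b) = (L ^^ n) a - (L ^^ n) b" for n a b
    by (induction n) (auto simp: linear_diff[OF L])
  have powT: "norm ((T ^^ n) z) \<le> norm z" for n z
    by (induction n) (auto intro: order_trans[OF contr])
  define v where "v = (\<lambda>n. (L ^^ n) (w - T w))"
  define \<delta> where "\<delta> = (INF n. norm (v n))"
  have bdd: "bdd_below (range (\<lambda>n. norm (v n)))"
    by (rule bdd_belowI[of _ 0]) auto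
  have dec: "decseq (\<lambda>n. norm (v n))"
    by (rule decseq_SucI) (simp add: v_def contrL)
  have lim: "(\<lambda>n. norm (v n)) \<longlonglongrightarrow> \<delta>"
    unfolding \<delta>_def by (rule LIMSEQ_decseq_INF[OF bdd dec])
  have key: "real (Suc m) * \<delta> \<le> 2 * norm w" for m
  proof -
    have bound: "2 ^ m * norm (v (m + n)) \<le> 2 * norm w + (2 ^ m - real m - 1) * norm (v n)" for n
    proof -
      have two: "((\<lambda>z. z + T z) ^^ m) z = 2 ^ m *\<^sub>R (L ^^ m) z" for z
      proof (induction m)
        case (Suc m)
        then show ?case by (simp add: L_def linear_scale[OF T] scaleR_add_right)
      qed simp
      have vn: "v n = (L ^^ n) w - T ((L ^^ n) w)"
        by (simp add: v_def powLdiff powLT)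
      have tele: "(\<Sum>j\<le>m. (T ^^ j) (z - T z)) = z - (T ^^ Suc m) z" for z
      proof -
        have "(T ^^ j) (z - T z) = (T ^^ j) z - (T ^^ Suc j) z" for j
          by (induction j) (auto simp: linear_diff[OF T])
        then show ?thesis by (induction m) auto
      qed
      have "norm (\<Sum>j\<le>m. (T ^^ j) (v n)) \<le> norm ((L ^^ n) w) + norm ((T ^^ Suc m) ((L ^^ n) w))"
        unfolding vn tele by (rule norm_triangle_ineq4)
      also have "\<dots> \<le> 2 * norm w"
        using powT[of "Suc m" "(L ^^ n) w"] powL[of n w] by linarith
      finally have "norm (\<Sum>j\<le>m. (T ^^ j) (v n)) \<le> 2 * norm w" .
      moreover have "norm (2 ^ m *\<^sub>R v (m + n) - (\<Sum>j\<le>m. (T ^^ j) (v n)))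
          \<le> (2 ^ m - real m - 1) * norm (v n)"
        using one_plus_contraction_power[OF T contr, of m "v n"]
        unfolding two by (simp add: v_def funpow_add)
      ultimately have "norm (2 ^ m *\<^sub>R v (m + n)) \<le> 2 * norm w + (2 ^ m - real m - 1) * norm (v n)"
        by (smt (verit) norm_triangle_sub)
      then show ?thesis by simp
    qed
    have lim1: "(\<lambda>n. 2 ^ m * norm (v (m + n))) \<longlonglongrightarrow> 2 ^ m * \<delta>"
      using LIMSEQ_ignore_initial_segment[OF lim, of m]
      by (intro tendsto_mult_left) (simp add: add.commute)
    have lim2: "(\<lambda>n. 2 * norm w + (2 ^ m - real m - 1) * norm (v n))
        \<longlonglongrightarrow> 2 * norm w + (2 ^ m - real m - 1) * \<delta>"
      by (intro tendsto_intros lim)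
    have "2 ^ m * \<delta> \<le> 2 * norm w + (2 ^ m - real m - 1) * \<delta>"
      by (rule LIMSEQ_le[OF lim1 lim2]) (use bound in blast)
    then show ?thesis by (simp add: algebra_simps)
  qed
  have "\<delta> \<le> 0"
  proof (rule ccontr)
    assume "\<not> \<delta> \<le> 0"
    then obtain m where "2 * norm w < real m * \<delta>"
      using ex_less_of_nat_mult[of \<delta> "2 * norm w"] by auto
    with key[of m] \<open>\<not> \<delta> \<le> 0\<close> show False by (simp add: algebra_simps)
  qed
  moreover have "0 \<le> \<delta>"
    unfolding \<delta>_def by (rule cINF_greatest) auto
  ultimately show ?thesis
    using lim tendsto_norm_zero_iff[of v sequentially] by (simp add: v_def)
qed

section \<open>Quasi-products\<close>

text \<open>The quasi-product e + f - e * f and the iterates below correspond to products and powers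
  of 1 - e and 1 - f in a unitization.\<close>

primrec quasi_power :: "'a::comm_ring \<Rightarrow> nat \<Rightarrow> 'a" where
  "quasi_power p 0 = 0"
| "quasi_power p (Suc n) = quasi_power p n + p - quasi_power p n * p"

lemma quasi_product_diff:
  fixes c e f :: "'a::comm_ring"
  shows "c - (e + f - e * f) * c = (c - f * c) - e * (c - f * c)"
  by (simp add: algebra_simps)

lemma quasi_power_diff:
  "c - quasi_power p n * c = ((\<lambda>z. z - p * z) ^^ n) c"
proof (induction n)
  case (Suc n)
  have "c - quasi_power p (Suc n) * c = (c - quasi_power p n * c) - p * (c - quasi_power p n * c)"
    by (simp add: algebra_simps)
  with Suc show ?case by simp
qed simp

text \<open>In a unitization this is ((1 - h)(1 - k))^n = (1 - k)^n (1 - h)^n. The fact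
  \<open>comm\<close> moves one factor 1 - h past the powers of 1 - k.\<close>

lemma funpow_quasi_product:
  fixes h k :: "'a::comm_ring"
  shows "((\<lambda>z. z - (h + k - h * k) * z) ^^ n) c = ((\<lambda>z. z - k * z) ^^ n) (((\<lambda>z. z - h * z) ^^ n) c)"
proof (induction n)
  case (Suc n)
  have comm: "((\<lambda>z. z - k * z) ^^ m) z - h * ((\<lambda>z. z - k * z) ^^ m) z
      = ((\<lambda>z. z - k * z) ^^ m) (z - h * z)" for m z
  proof (induction m)
    case (Suc m)
    have swap: "(u - k * u) - h * (u - k * u) = (u - h * u) - k * (u - h * u)" for u
      by (simp add: algebra_simps)
    show ?case by (simp only: funpow.simps comp_apply swap Suc)
  qed simp
  show ?case
    using Suc comm[of "Suc n"] by (simp add: quasi_product_diff)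
qed simp

section \<open>Commutative approximately unital Banach algebras\<close>

locale comm_approx_unital_algebra =
  fixes cs :: "complex \<Rightarrow> 'a::{real_normed_algebra,comm_ring,banach} \<Rightarrow> 'a"
  assumes scaling: "complex_scaling cs"
    and approx_unit: "approx_unital TYPE('a)"
begin

lemma cs_add: "cs c (a + b) = cs c a + cs c b"
  and cs_plus: "cs (c + d) a = cs c a + cs d a"
  and cs_cs: "cs c (cs d a) = cs (c * d) a"
  and cs_of_real: "cs (complex_of_real r) a = r *\<^sub>R a"
  and norm_cs: "norm (cs c a) = cmod c * norm a"
  and cs_mult_left: "cs c a * b = cs c (a * b)"
  and cs_mult_right: "a * cs c b = cs c (a * b)"
  using scaling unfolding complex_scaling_def by metis+

lemma cs_one: "cs 1 a = a"
  using cs_of_real[of 1 a] by simp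

lemma cs_minus_one: "cs (- 1) a = - a"
  using cs_of_real[of "- 1" a] by simp

lemma cs_scaleR: "cs c (r *\<^sub>R a) = r *\<^sub>R cs c a"
  by (simp add: cs_of_real[symmetric] cs_cs mult.commute)

lemma bounded_linear_cs: "bounded_linear (cs c)"
  by (rule bounded_linear_intro[where K = "cmod c"]) (simp_all add: cs_add cs_scaleR norm_cs mult.commute)

subsection \<open>The sets F and r\<close>

lemma norm_le_unit_norm:
  assumes "norm c \<le> 1"
  shows "norm (a * c + cs l c) \<le> unit_norm cs a l"
  unfolding unit_norm_def
proof (rule cSup_upper)
  show "bdd_above {norm (a * c + cs l c) |c. norm c \<le> 1}"
  proof (rule bdd_aboveI)
    fix r
    assume "r \<in> {norm (a * c + cs l c) |c. norm c \<le> 1}"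
    then obtain c where c: "norm c \<le> 1" and r: "r = norm (a * c + cs l c)" by blast
    have "r \<le> norm (a * c) + norm (cs l c)"
      unfolding r by (rule norm_triangle_ineq)
    also have "\<dots> \<le> norm a * norm c + cmod l * norm c"
      by (simp add: norm_cs norm_mult_ineq)
    also have "\<dots> \<le> norm a + cmod l"
      using c by (intro add_mono) (simp_all add: mult_left_le)
    finally show "r \<le> norm a + cmod l" .
  qed
qed (use assms in blast)

lemma unit_norm_le:
  assumes "\<And>c. norm c \<le> 1 \<Longrightarrow> norm (a * c + cs l c) \<le> m"
  shows "unit_norm cs a l \<le> m"
  unfolding unit_norm_def
proof (rule cSup_least)
  show "{norm (a * c + cs l c) |c. norm c \<le> 1} \<noteq> {}"
    by (auto intro: exI[of _ 0])
qed (use assms in auto)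

text \<open>Rescaling to the unit ball removes the supremum. This is the form in which membership in
  F is used in most of what follows.\<close>

lemma frakF_iff: "x \<in> frakF cs \<longleftrightarrow> (\<forall>c. norm (c - x * c) \<le> norm c)"
proof
  assume x: "x \<in> frakF cs"
  show "\<forall>c. norm (c - x * c) \<le> norm c"
  proof
    fix c
    show "norm (c - x * c) \<le> norm c"
    proof (cases "c = 0")
      case False
      define d where "d = (1 / norm c) *\<^sub>R c"
      have "norm (- x * d + cs 1 d) \<le> unit_norm cs (- x) 1"
        using False by (intro norm_le_unit_norm) (simp add: d_def)
      also have "\<dots> \<le> 1"
        using x by (simp add: frakF_def)
      also have "- x * d + cs 1 d = (1 / norm c) *\<^sub>R (c - x * c)"
        by (simp add: cs_one d_def scaleR_right_diff_distrib)
      finally show ?thesis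
        using False by (simp add: divide_le_eq)
    qed simp
  qed
next
  assume x: "\<forall>c. norm (c - x * c) \<le> norm c"
  have "unit_norm cs (- x) 1 \<le> 1"
  proof (rule unit_norm_le)
    fix c :: 'a
    assume "norm c \<le> 1"
    then show "norm (- x * c + cs 1 c) \<le> 1"
      using x[rule_format, of c] by (simp add: cs_one)
  qed
  then show "x \<in> frakF cs" by (simp add: frakF_def)
qed

lemma frakF_contraction: "x \<in> frakF cs \<Longrightarrow> norm (c - x * c) \<le> norm c"
  by (simp add: frakF_iff)

lemma zero_in_frakF: "0 \<in> frakF cs"
  by (simp add: frakF_iff)

text \<open>A state sends 1 - x into the closed unit disc, and 1 - f(x) in that disc forces the real
  part of f(x) to be nonnegative.\<close>

lemma frakF_subset_frakr: "frakF cs \<subseteq> frakr cs"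
proof
  fix x
  assume x: "x \<in> frakF cs"
  have "0 \<le> Re (f x)" if f: "unit_state cs f" for f
  proof -
    have "f (- x) = - f x"
      using f unfolding unit_state_def by (metis cs_minus_one mult_minus1)
    moreover have "cmod (f (- x) + 1) \<le> unit_norm cs (- x) 1"
      using f by (simp add: unit_state_def)
    moreover have "unit_norm cs (- x) 1 \<le> 1"
      using x by (simp add: frakF_def)
    ultimately show ?thesis
      using complex_Re_le_cmod[of "- f x + 1"] abs_Re_le_cmod[of "- f x + 1"] by simp
  qed
  then show "x \<in> frakr cs" by (simp add: frakr_def)
qed

lemma frakF_half:
  assumes "x \<in> frakF cs"
  shows "(1/2) *\<^sub>R x \<in> frakF cs"
  unfolding frakF_iff
proof
  fix c
  have "c - (1/2) *\<^sub>R x * c = (1/2) *\<^sub>R (c + (c - x * c))"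
    by (simp add: add_diff_eq scaleR_right_diff_distrib scaleR_half_double)
  moreover have "norm (c + (c - x * c)) \<le> norm c + norm c"
    using frakF_contraction[OF assms, of c] norm_triangle_ineq[of c "c - x * c"] by linarith
  ultimately show "norm (c - (1/2) *\<^sub>R x * c) \<le> norm c" by simp
qed

lemma norm_quasi_product_le:
  assumes "e \<in> frakF cs"
  shows "norm (c - (e + f - e * f) * c) \<le> norm (c - f * c)"
  unfolding quasi_product_diff by (rule frakF_contraction[OF assms])

lemma frakF_quasi_product:
  assumes "e \<in> frakF cs" and "f \<in> frakF cs"
  shows "e + f - e * f \<in> frakF cs"
  unfolding frakF_iff
  using norm_quasi_product_le[OF assms(1)] frakF_contraction[OF assms(2)] order_trans by blast

lemma frakF_quasi_power:
  assumes "p \<in> frakF cs"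
  shows "quasi_power p n \<in> frakF cs"
  by (induction n) (simp_all add: zero_in_frakF frakF_quasi_product assms)

text \<open>Along the contractive approximate identity, \<open>e * x\<close> is the difference of
  \<open>e\<close> and \<open>e - x * e\<close>, both of norm at most 1. This makes any approximate
  identity in F bounded.\<close>

lemma norm_frakF_le:
  assumes x: "x \<in> frakF cs"
  shows "norm x \<le> 2"
proof -
  obtain G :: "'a filter" where G: "G \<noteq> bot" "\<forall>\<^sub>F e in G. norm e \<le> 1"
    "((\<lambda>e. e * x) \<longlongrightarrow> x) G"
    using approx_unit by (auto simp: approx_unital_def)
  have "\<forall>\<^sub>F e in G. norm (e * x) \<le> 2"
    using G(2)
  proof eventually_elim
    case (elim e)
    have "norm (e * x) \<le> norm e + norm (e - x * e)"
      using norm_triangle_ineq4[of e "e - x * e"] by (simp add: mult.commute)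
    with elim frakF_contraction[OF x, of e] show ?case by simp
  qed
  then show ?thesis
    using tendsto_upperbound[OF tendsto_norm[OF G(3)]] G(1) by blast
qed

text \<open>A complex functional is recovered from its real part \<open>u\<close> by taking
  \<open>- u (cs \<i> a)\<close> as imaginary part. Rotating \<open>a\<close> by a unimodular scalar
  makes \<open>g a\<close> real and nonnegative, which transfers the bound. At \<open>z\<close> the
  real part already exhausts the bound, so the imaginary part is zero.\<close>

lemma exists_complex_norming_functional:
  "\<exists>g. (\<forall>a b. g (a + b) = g a + g b) \<and> (\<forall>c a. g (cs c a) = c * g a) \<and>
     (\<forall>a. cmod (g a) \<le> norm a) \<and> g z = complex_of_real (norm z)"
proof -
  obtain u where u: "linear u" "\<And>a. u a \<le> norm a" "u z = norm z"
    using exists_real_norming_functional[of z] by blast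
  define g where "g = (\<lambda>a. Complex (u a) (- u (cs \<i> a)))"
  have add: "g (a + b) = g a + g b" for a b
    by (simp add: g_def linear_add[OF u(1)] cs_add complex_eq_iff)
  have scale: "g (cs c a) = c * g a" for c a
  proof -
    have u_cs: "u (cs d a) = Re d * u a + Im d * u (cs \<i> a)" for d
    proof -
      have "cs d a = cs (complex_of_real (Re d) + complex_of_real (Im d) * \<i>) a"
        by (metis complex_eq mult.commute)
      also have "\<dots> = Re d *\<^sub>R a + Im d *\<^sub>R cs \<i> a"
        by (simp add: cs_plus cs_of_real flip: cs_cs)
      finally show ?thesis
        by (simp add: linear_add[OF u(1)] linear_scale[OF u(1)])
    qed
    show ?thesis
      by (simp add: g_def cs_cs u_cs[of c] u_cs[of "\<i> * c"] complex_eq_iff)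
  qed
  have bound: "cmod (g a) \<le> norm a" for a
  proof (cases "g a = 0")
    case False
    define c where "c = cnj (g a) / cmod (g a)"
    have "g (cs c a) = complex_of_real (cmod (g a))"
      using False by (simp add: scale c_def complex_norm_square[symmetric] mult.commute power2_eq_square
          del: of_real_power)
    then have "u (cs c a) = cmod (g a)"
      by (simp add: g_def complex_eq_iff)
    moreover have "cmod c = 1"
      using False by (simp add: c_def norm_divide)
    ultimately show ?thesis
      using u(2)[of "cs c a"] by (simp add: norm_cs)
  qed simp
  have "g z = complex_of_real (norm z)"
  proof -
    have "Re (g z) = norm z" using u(3) by (simp add: g_def)
    moreover have "(cmod (g z))\<^sup>2 \<le> (norm z)\<^sup>2"
      using bound[of z] by (intro power_mono) auto
    ultimately have "Im (g z) = 0"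
      by (simp add: cmod_power2)
    with \<open>Re (g z) = norm z\<close> show ?thesis by (simp add: complex_eq_iff)
  qed
  with add scale bound show ?thesis by blast
qed

text \<open>A functional g norming z turns into the state a + l1 \<mapsto> g (az + lz).\<close>

lemma frakr_norm_le:
  assumes x: "x \<in> frakr cs"
  shows "norm z \<le> norm (z + x * z)"
proof (cases "z = 0")
  case False
  \<comment> \<open>With \<open>norm y = 1\<close> the norming functional has
    \<open>g y = 1\<close>, so the induced functional takes the value 1 at the identity.\<close>
  define y where "y = (1 / norm z) *\<^sub>R z"
  have y: "norm y = 1" using False by (simp add: y_def)
  obtain g where g: "\<And>a b. g (a + b) = g a + g b" "\<And>c a. g (cs c a) = c * g a"
    "\<And>a. cmod (g a) \<le> norm a" "g y = 1"
    using exists_complex_norming_functional[of y] y by auto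
  have "unit_state cs (\<lambda>a. g (a * y))"
    unfolding unit_state_def
  proof (intro conjI allI)
    fix a l
    have "cmod (g (a * y) + l) = cmod (g (a * y + cs l y))"
      by (simp add: g)
    also have "\<dots> \<le> norm (a * y + cs l y)" by (rule g(3))
    also have "\<dots> \<le> unit_norm cs a l"
      using y by (intro norm_le_unit_norm) simp
    finally show "cmod (g (a * y) + l) \<le> unit_norm cs a l" .
  qed (simp_all add: g distrib_right cs_mult_left)
  with x have "0 \<le> Re (g (x * y))" unfolding frakr_def by blast
  then have "1 \<le> Re (g (y + x * y))" by (simp add: g)
  also have "\<dots> \<le> norm (y + x * y)"
    using complex_Re_le_cmod g(3) order_trans by blast
  also have "y + x * y = (1 / norm z) *\<^sub>R (z + x * z)"
    by (simp add: y_def algebra_simps)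
  finally show ?thesis
    using False by (simp add: le_divide_eq)
qed simp

text \<open>Here y is the Cayley-type transform sx(1 + sx)^(-1), with s small enough for the inverse
  to exist in a unitization.\<close>

lemma frakr_same_range_frakF:
  assumes x: "x \<in> frakr cs"
  shows "\<exists>y\<in>frakF cs. range (\<lambda>a. y * a) = range (\<lambda>a. x * a)"
proof -
  \<comment> \<open>This makes \<open>norm x'\<close> at most 1/2, so that the map
    \<open>y \<mapsto> x' - x' * y\<close> is a contraction with constant 1/2.\<close>
  define s where "s = 1 / (2 * (norm x + 1))"
  have s: "0 < s" "s * norm x \<le> 1/2"
    using norm_ge_zero[of x] by (auto simp: s_def field_simps add_pos_nonneg)
  define x' where "x' = s *\<^sub>R x"
  have x': "norm x' \<le> 1/2" using s by (simp add: x'_def)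
  have "x' \<in> frakr cs"
    unfolding frakr_def
  proof (intro CollectI allI impI)
    fix f
    assume f: "unit_state cs f"
    then have "f x' = s * f x"
      by (simp add: x'_def unit_state_def flip: cs_of_real)
    with x f s show "0 \<le> Re (f x')" by (simp add: frakr_def)
  qed
  \<comment> \<open>The fixed point solves (1 + x') y = x'; Banach's theorem thus replaces inverting
    1 + x'.\<close>
  have "\<exists>!y. x' - x' * y = y"
  proof (rule banach_fix_type[of "1/2"])
    show "\<forall>a b. dist (x' - x' * a) (x' - x' * b) \<le> 1/2 * dist a b"
    proof (intro allI)
      fix a b
      have "dist (x' - x' * a) (x' - x' * b) = norm (x' * (b - a))"
        by (simp add: dist_norm right_diff_distrib)
      also have "\<dots> \<le> norm x' * norm (b - a)" by (rule norm_mult_ineq)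
      also have "\<dots> \<le> 1/2 * norm (b - a)"
        using x' by (intro mult_right_mono) auto
      finally show "dist (x' - x' * a) (x' - x' * b) \<le> 1/2 * dist a b"
        by (simp add: dist_norm norm_minus_commute)
    qed
  qed auto
  then obtain y where y: "x' - x' * y = y" by blast
  have "y \<in> frakF cs"
    unfolding frakF_iff
  proof
    fix c
    \<comment> \<open>This is (1 + x')(1 - y) = 1. Since 1 + x' does not decrease norms, 1 - y is a
      contraction.\<close>
    have "(c - y * c) + x' * (c - y * c) = c + ((x' - x' * y) - y) * c"
      by (simp add: algebra_simps)
    also have "\<dots> = c" by (simp add: y)
    finally show "norm (c - y * c) \<le> norm c"
      using frakr_norm_le[OF \<open>x' \<in> frakr cs\<close>, of "c - y * c"] by simp
  qed
  \<comment> \<open>The two inclusions of ranges come from y = x'(1 - y) and x' = y(1 + x').\<close>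
  moreover have "y * a = x * (s *\<^sub>R (a - y * a))" for a
  proof -
    have "y * a = (x' - x' * y) * a" by (simp add: y)
    then show ?thesis by (simp add: x'_def algebra_simps)
  qed
  moreover have "x * a = y * ((1 / s) *\<^sub>R (a + x' * a))" for a
  proof -
    have "y * (a + x' * a) = (x' - x' * y) * a + x' * y * a"
      by (simp add: y algebra_simps)
    also have "\<dots> = s *\<^sub>R (x * a)" by (simp add: x'_def algebra_simps)
    finally show ?thesis using s by simp
  qed
  ultimately show ?thesis by blast
qed

subsection \<open>Closed ideals\<close>

lemma complex_subspace_closure:
  assumes V: "complex_subspace cs V"
  shows "complex_subspace cs (closure V)"
  unfolding complex_subspace_def
proof (intro conjI ballI allI)
  show "0 \<in> closure V"
    using V closure_subset by (auto simp: complex_subspace_def)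
  show "a + b \<in> closure V" if ab: "a \<in> closure V" "b \<in> closure V" for a b
  proof -
    from ab obtain f g where "\<And>n. f n \<in> V" "f \<longlonglongrightarrow> a" "\<And>n. g n \<in> V" "g \<longlonglongrightarrow> b"
      unfolding closure_sequential by blast
    with V have "\<And>n. f n + g n \<in> V" "(\<lambda>n. f n + g n) \<longlonglongrightarrow> a + b"
      by (auto simp: complex_subspace_def intro: tendsto_add)
    then show ?thesis
      unfolding closure_sequential by (intro exI[of _ "\<lambda>n. f n + g n"]) simp
  qed
  show "cs c a \<in> closure V" if a: "a \<in> closure V" for c a
  proof -
    from a obtain f where "\<And>n. f n \<in> V" "f \<longlonglongrightarrow> a"
      unfolding closure_sequential by blast
    with V have "\<And>n. cs c (f n) \<in> V" "(\<lambda>n. cs c (f n)) \<longlonglongrightarrow> cs c a"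
      by (auto simp: complex_subspace_def intro: bounded_linear.tendsto[OF bounded_linear_cs])
    then show ?thesis
      unfolding closure_sequential by (intro exI[of _ "\<lambda>n. cs c (f n)"]) simp
  qed
qed

lemma complex_subspace_cspan: "complex_subspace cs (cspan cs S)"
  unfolding complex_subspace_def cspan_def by blast

lemma cspan_superset: "S \<subseteq> cspan cs S"
  unfolding cspan_def by blast

lemma cspan_least: "complex_subspace cs V \<Longrightarrow> S \<subseteq> V \<Longrightarrow> cspan cs S \<subseteq> V"
  unfolding cspan_def by blast

lemma is_ideal_iff:
  "is_ideal cs J \<longleftrightarrow> complex_subspace cs J \<and> (\<forall>a\<in>J. \<forall>b. a * b \<in> J)"
  by (auto simp: is_ideal_def complex_subspace_def)

lemma ideal_diff:
  assumes "is_ideal cs J" and "a \<in> J" and "b \<in> J"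
  shows "a - b \<in> J"
proof -
  have "cs (- 1) b \<in> J" using assms by (simp add: is_ideal_def)
  with assms have "a + - b \<in> J" unfolding is_ideal_def cs_minus_one by blast
  then show ?thesis by simp
qed

lemma ideal_scaleR:
  assumes "is_ideal cs J" and "a \<in> J"
  shows "r *\<^sub>R a \<in> J"
  using assms unfolding is_ideal_def cs_of_real[symmetric] by blast

lemma ideal_quasi_product:
  assumes "is_ideal cs J" and "e \<in> J" and "f \<in> J"
  shows "e + f - e * f \<in> J"
  using assms by (intro ideal_diff[OF assms(1)]) (auto simp: is_ideal_def)

lemma ideal_quasi_power:
  assumes "is_ideal cs J" and "p \<in> J"
  shows "quasi_power p n \<in> J"
proof (induction n)
  case 0
  then show ?case using assms by (simp add: is_ideal_def)
next
  case (Suc n)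
  then show ?case using ideal_quasi_product[OF assms(1) _ assms(2)] by simp
qed

lemma closed_closedEA: "closed (closedEA cs E)"
  by (simp add: closedEA_def)

lemma complex_subspace_closedEA: "complex_subspace cs (closedEA cs E)"
  unfolding closedEA_def by (intro complex_subspace_closure complex_subspace_cspan)

lemma mult_in_closedEA: "x \<in> E \<Longrightarrow> x * a \<in> closedEA cs E"
  unfolding closedEA_def
  by (rule subsetD[OF closure_subset], rule subsetD[OF cspan_superset]) auto

lemma closedEA_least:
  assumes "complex_subspace cs V" and "closed V" and "\<And>x a. x \<in> E \<Longrightarrow> x * a \<in> V"
  shows "closedEA cs E \<subseteq> V"
  unfolding closedEA_def using assms by (intro closure_minimal cspan_least) auto

lemma closedEA_mono: "E \<subseteq> E' \<Longrightarrow> closedEA cs E \<subseteq> closedEA cs E'"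
  by (intro closedEA_least complex_subspace_closedEA closed_closedEA) (auto intro: mult_in_closedEA)

lemma is_ideal_closedEA: "is_ideal cs (closedEA cs E)"
proof -
  have "a * b \<in> closedEA cs E" if "a \<in> closedEA cs E" for a b
  proof -
    have "complex_subspace cs {a. a * b \<in> closedEA cs E}"
      using complex_subspace_closedEA[of E]
      by (auto simp: complex_subspace_def distrib_right cs_mult_left)
    moreover have "closed {a. a * b \<in> closedEA cs E}"
      using closed_vimage[OF closed_closedEA[of E], of "\<lambda>a. a * b"]
      by (simp add: vimage_def continuous_intros)
    ultimately have "closedEA cs E \<subseteq> {a. a * b \<in> closedEA cs E}"
      by (rule closedEA_least) (simp add: mult.assoc mult_in_closedEA)
    with that show ?thesis by blast
  qed
  then show ?thesis by (simp add: is_ideal_iff complex_subspace_closedEA)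
qed

text \<open>The approximate identity of the algebra exhibits \<open>x\<close> as a limit of products
  \<open>e * x = x * e\<close>.\<close>

lemma subset_closedEA: "E \<subseteq> closedEA cs E"
proof
  fix x
  assume x: "x \<in> E"
  obtain G :: "'a filter" where G: "G \<noteq> bot" "((\<lambda>e. e * x) \<longlongrightarrow> x) G"
    using approx_unit by (auto simp: approx_unital_def)
  have "\<forall>\<^sub>F e in G. e * x \<in> closedEA cs E"
    using mult_in_closedEA[OF x] by (simp add: mult.commute)
  with closed_closedEA G show "x \<in> closedEA cs E"
    by (metis Lim_in_closed_set)
qed

lemma closedEA_eqI:
  assumes "range (\<lambda>a. y * a) = range (\<lambda>a. x * a)"
  shows "closedEA cs {y} = closedEA cs {x}"
proof -
  have "{y' * a |y' a. y' \<in> {y}} = {x' * a |x' a. x' \<in> {x}}"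
    using assms by (auto simp: set_eq_iff image_iff)
  then show ?thesis by (simp add: closedEA_def)
qed

text \<open>Each generator is exchanged for one in F with the same range of multiplication, so the
  spanning set of products does not change at all.\<close>

lemma closedEA_frakr_frakF:
  assumes "E \<subseteq> frakr cs"
  shows "\<exists>E'\<subseteq>frakF cs. closedEA cs E' = closedEA cs E"
proof -
  have "\<forall>x\<in>E. \<exists>y\<in>frakF cs. range (\<lambda>a. y * a) = range (\<lambda>a. x * a)"
    using assms frakr_same_range_frakF by blast
  then obtain h where h: "\<And>x. x \<in> E \<Longrightarrow> h x \<in> frakF cs"
    "\<And>x. x \<in> E \<Longrightarrow> range (\<lambda>a. h x * a) = range (\<lambda>a. x * a)"
    by metis
  have "{y * a |y a. y \<in> h ` E} = (\<Union>x\<in>E. range (\<lambda>a. h x * a))" by blast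
  also have "\<dots> = (\<Union>x\<in>E. range (\<lambda>a. x * a))" using h(2) by simp
  also have "\<dots> = {x * a |x a. x \<in> E}" by blast
  finally have "closedEA cs (h ` E) = closedEA cs E" by (simp add: closedEA_def)
  with h(1) show ?thesis by blast
qed

subsection \<open>Approximate identities\<close>

text \<open>For T = 1 - x the average of 1 and T is 1 - x/2, and \<open>w - T w\<close> is
  \<open>x * w\<close>.\<close>

lemma frakF_half_power_tendsto_zero:
  assumes x: "x \<in> frakF cs"
  shows "(\<lambda>n. ((\<lambda>z. z - (1/2) *\<^sub>R x * z) ^^ n) (x * c)) \<longlonglongrightarrow> 0"
proof -
  have "linear (\<lambda>z. z - x * z)"
    by (rule linearI) (simp_all add: algebra_simps)
  from averaged_contraction_power_tendsto_zero[OF this frakF_contraction[OF x], of c]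
  have "(\<lambda>n. ((\<lambda>z. (1/2) *\<^sub>R (z + (z - x * z))) ^^ n) (x * c)) \<longlonglongrightarrow> 0"
    by simp
  moreover have "(\<lambda>z. (1/2) *\<^sub>R (z + (z - x * z))) = (\<lambda>z. z - (1/2) *\<^sub>R x * z)"
    by (rule ext) (simp add: add_diff_eq scaleR_right_diff_distrib scaleR_half_double)
  ultimately show ?thesis by simp
qed

text \<open>Quasi-products improve on both factors simultaneously, so it suffices to
  approximate one element at a time.\<close>

lemma has_bai_in_frakFI:
  assumes J: "is_ideal cs J"
    and approx: "\<And>a \<epsilon>. a \<in> J \<Longrightarrow> 0 < \<epsilon> \<Longrightarrow> \<exists>e\<in>J \<inter> frakF cs. norm (a - e * a) < \<epsilon>"
  shows "has_bai_in J (frakF cs)"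
proof -
  \<comment> \<open>The sets \<open>S (a, \<epsilon>)\<close> are to generate the filter of the
    approximate identity. It is proper once finitely many of them always meet.\<close>
  define S where "S = (\<lambda>(a, \<epsilon>::real). {e \<in> J \<inter> frakF cs. norm (a - e * a) < \<epsilon>})"
  define B where "B = J \<times> {0::real <..}"
  define G where "G = (INF b\<in>B. principal (S b))"
  have ev: "\<forall>\<^sub>F e in G. e \<in> S b" if "b \<in> B" for b
    unfolding G_def
    by (intro eventually_INF1[OF that]) (simp add: eventually_principal)
  \<comment> \<open>Keeping \<open>J \<inter> frakF cs\<close> in the intersection gives the
    induction an element, namely 0, when \<open>X\<close> is empty.\<close>
  have fip: "J \<inter> frakF cs \<inter> (\<Inter>b\<in>X. S b) \<noteq> {}" if "finite X" "X \<subseteq> B" for X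
    using that
  proof (induction X)
    case empty
    have "0 \<in> J" using J by (simp add: is_ideal_def)
    then show ?case using zero_in_frakF by auto
  next
    case (insert b X)
    then obtain e where e: "e \<in> J" "e \<in> frakF cs" "\<And>b. b \<in> X \<Longrightarrow> e \<in> S b" by auto
    obtain a \<epsilon> where b: "b = (a, \<epsilon>)" "a \<in> J" "0 < \<epsilon>"
      using insert.prems by (auto simp: B_def)
    obtain f where f: "f \<in> J" "f \<in> frakF cs" "norm (a - f * a) < \<epsilon>"
      using approx[OF b(2,3)] by blast
    define u where "u = e + f - e * f"
    have u: "u \<in> J" "u \<in> frakF cs"
      using e f by (simp_all add: u_def ideal_quasi_product[OF J] frakF_quasi_product)
    have "norm (c - u * c) \<le> norm (c - f * c)" for c
      unfolding u_def by (rule norm_quasi_product_le[OF e(2)])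
    then have "u \<in> S b" using f(3) u by (auto simp: S_def b intro: le_less_trans)
    moreover have "norm (c - u * c) \<le> norm (c - e * c)" for c
      using norm_quasi_product_le[OF f(2), of c e] by (simp add: u_def add.commute mult.commute)
    then have "u \<in> S b'" if "b' \<in> X" for b'
      using e(3)[OF that] u by (auto simp: S_def intro: le_less_trans)
    ultimately show ?case using u by auto
  qed
  have "G \<noteq> bot"
    unfolding G_def
  proof (rule INF_filter_not_bot)
    fix X
    assume X: "X \<subseteq> B" "finite X"
    have "(\<Inter>b\<in>X. S b) \<noteq> {}" using fip[OF X(2,1)] by blast
    then show "(INF b\<in>X. principal (S b)) \<noteq> bot"
      using X(2) by (simp add: INF_principal_finite principal_eq_bot_iff)
  qed
  \<comment> \<open>For \<open>a = 0\<close> the estimate is vacuous, so \<open>S (0, 1)\<close> is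
    all of \<open>J \<inter> frakF cs\<close>.\<close>
  moreover have "(0, 1) \<in> B" using J by (simp add: B_def is_ideal_def)
  from ev[OF this] have "\<forall>\<^sub>F e in G. e \<in> J \<and> e \<in> frakF cs \<and> norm e \<le> 2"
    by eventually_elim (auto simp: S_def norm_frakF_le)
  moreover have "((\<lambda>e. e * a) \<longlongrightarrow> a) G" if "a \<in> J" for a
  proof (rule tendstoI)
    fix \<epsilon> :: real
    assume "0 < \<epsilon>"
    with that have "(a, \<epsilon>) \<in> B" by (simp add: B_def)
    from ev[OF this] show "\<forall>\<^sub>F e in G. dist (e * a) a < \<epsilon>"
      by eventually_elim (auto simp: S_def dist_norm norm_minus_commute)
  qed
  ultimately show ?thesis unfolding has_bai_in_def by blast
qed

text \<open>The elements that can be approximated individually form a closed complex subspace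
  \<open>V\<close>. It contains all products \<open>x * a\<close> with \<open>x\<close> in
  \<open>E\<close>, hence the whole of \<open>closedEA cs E\<close>.\<close>

lemma has_bai_in_closedEA:
  assumes E: "E \<subseteq> frakF cs"
  shows "has_bai_in (closedEA cs E) (frakF cs)"
proof (rule has_bai_in_frakFI[OF is_ideal_closedEA])
  define J where "J = closedEA cs E"
  have J: "is_ideal cs J" by (simp add: J_def is_ideal_closedEA)
  define V where "V = {a. \<forall>\<epsilon>>0. \<exists>e\<in>J \<inter> frakF cs. norm (a - e * a) < \<epsilon>}"
  have "J \<subseteq> V"
    unfolding J_def
  proof (rule closedEA_least)
    show "complex_subspace cs V"
      unfolding complex_subspace_def
    proof (intro conjI ballI allI)
      have "0 \<in> J" using J by (simp add: is_ideal_def)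
      then show "0 \<in> V" using zero_in_frakF by (auto simp: V_def)
      show "a + b \<in> V" if ab: "a \<in> V" "b \<in> V" for a b
        unfolding V_def
      proof (intro CollectI allI impI)
        fix \<epsilon> :: real
        assume "0 < \<epsilon>"
        then have "0 < \<epsilon> / 2" by simp
        with ab obtain e f where e: "e \<in> J" "e \<in> frakF cs" "norm (a - e * a) < \<epsilon> / 2"
          and f: "f \<in> J" "f \<in> frakF cs" "norm (b - f * b) < \<epsilon> / 2"
          unfolding V_def by blast
        \<comment> \<open>As 1 - u = (1 - e)(1 - f), this one element does at least as well as
          \<open>e\<close> on \<open>a\<close> and as \<open>f\<close> on \<open>b\<close>.\<close>
        define u where "u = e + f - e * f"
        have "(a + b) - u * (a + b) = (a - u * a) + (b - u * b)"
          by (simp add: algebra_simps)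
        then have "norm ((a + b) - u * (a + b)) \<le> norm (a - u * a) + norm (b - u * b)"
          by (simp only: norm_triangle_ineq)
        moreover have "norm (b - u * b) \<le> norm (b - f * b)"
          unfolding u_def by (rule norm_quasi_product_le[OF e(2)])
        moreover have "norm (a - u * a) \<le> norm (a - e * a)"
          using norm_quasi_product_le[OF f(2), of a e] by (simp add: u_def add.commute mult.commute)
        ultimately have "norm ((a + b) - u * (a + b)) < \<epsilon>"
          using e(3) f(3) by linarith
        moreover have "u \<in> J \<inter> frakF cs"
          using e f by (simp add: u_def ideal_quasi_product[OF J] frakF_quasi_product)
        ultimately show "\<exists>u\<in>J \<inter> frakF cs. norm ((a + b) - u * (a + b)) < \<epsilon>" by blast
      qed
      show "cs c a \<in> V" if a: "a \<in> V" for c a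
        unfolding V_def
      proof (intro CollectI allI impI)
        fix \<epsilon> :: real
        assume "0 < \<epsilon>"
        \<comment> \<open>The summand 1 covers the case \<open>c = 0\<close>.\<close>
        then have "0 < \<epsilon> / (cmod c + 1)" by (simp add: add_nonneg_pos)
        with a obtain e where e: "e \<in> J \<inter> frakF cs" "norm (a - e * a) < \<epsilon> / (cmod c + 1)"
          unfolding V_def by blast
        have "cs c a - e * cs c a = cs c (a - e * a)"
          by (simp add: cs_mult_right linear_diff[OF bounded_linear.linear[OF bounded_linear_cs]])
        then have "norm (cs c a - e * cs c a) \<le> (cmod c + 1) * norm (a - e * a)"
          by (simp add: norm_cs mult_right_mono)
        also have "\<dots> < \<epsilon>"
          using e(2) by (simp add: less_divide_eq add_nonneg_pos mult.commute)
        finally show "\<exists>e\<in>J \<inter> frakF cs. norm (cs c a - e * cs c a) < \<epsilon>"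
          using e(1) by blast
      qed
    qed
    show "closed V"
      unfolding closure_subset_eq[symmetric]
    proof
      fix a
      assume a: "a \<in> closure V"
      show "a \<in> V"
        unfolding V_def
      proof (intro CollectI allI impI)
        fix \<epsilon> :: real
        assume "0 < \<epsilon>"
        then have "0 < \<epsilon> / 2" by simp
        with a obtain b where b: "b \<in> V" "dist b a < \<epsilon> / 2"
          unfolding closure_approachable by blast
        with \<open>0 < \<epsilon> / 2\<close> obtain e where e: "e \<in> J" "e \<in> frakF cs" "norm (b - e * b) < \<epsilon> / 2"
          unfolding V_def by blast
        have "a - e * a = ((a - b) - e * (a - b)) + (b - e * b)"
          by (simp add: algebra_simps)
        then have "norm (a - e * a) \<le> norm ((a - b) - e * (a - b)) + norm (b - e * b)"
          by (simp only: norm_triangle_ineq)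
        also have "\<dots> < \<epsilon>"
          using frakF_contraction[OF e(2), of "a - b"] b(2) e(3)
          by (simp add: dist_norm norm_minus_commute)
        finally show "\<exists>e\<in>J \<inter> frakF cs. norm (a - e * a) < \<epsilon>"
          using e by blast
      qed
    qed
    fix x a
    assume x: "x \<in> E"
    \<comment> \<open>Since 1 - \<open>quasi_power h n\<close> is (1 - h)^n, the iterates of
      \<open>h\<close> act on \<open>x * a\<close> with error tending to 0.\<close>
    define h where "h = (1/2) *\<^sub>R x"
    have h: "h \<in> J" "h \<in> frakF cs"
      using x E subset_closedEA[of E]
      by (auto simp: h_def J_def intro!: frakF_half ideal_scaleR is_ideal_closedEA)
    show "x * a \<in> V"
      unfolding V_def
    proof (intro CollectI allI impI)
      fix \<epsilon> :: real
      assume "0 < \<epsilon>"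
      have "(\<lambda>n. x * a - quasi_power h n * (x * a)) \<longlonglongrightarrow> 0"
        using frakF_half_power_tendsto_zero[of x a] x E
        by (auto simp: quasi_power_diff h_def)
      then obtain n where "norm (x * a - quasi_power h n * (x * a)) < \<epsilon>"
        using \<open>0 < \<epsilon>\<close> by (auto simp: LIMSEQ_iff)
      then show "\<exists>e\<in>J \<inter> frakF cs. norm (x * a - e * (x * a)) < \<epsilon>"
        using h by (intro bexI[of _ "quasi_power h n"])
          (auto intro: ideal_quasi_power[OF J] frakF_quasi_power)
    qed
  qed
  then show "\<exists>e\<in>closedEA cs E \<inter> frakF cs. norm (a - e * a) < \<epsilon>"
    if "a \<in> closedEA cs E" "0 < \<epsilon>" for a \<epsilon>
    using that unfolding V_def J_def by blast
qed

lemma has_bai_in_mono: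
  assumes "has_bai_in J S" and "S \<subseteq> S'"
  shows "has_bai_in J S'"
proof -
  obtain G M where G: "G \<noteq> bot" "\<forall>\<^sub>F e in G. e \<in> J \<and> e \<in> S \<and> norm e \<le> M"
    "\<forall>a\<in>J. ((\<lambda>e. e * a) \<longlongrightarrow> a) G"
    using assms(1) unfolding has_bai_in_def by blast
  have "\<forall>\<^sub>F e in G. e \<in> J \<and> e \<in> S' \<and> norm e \<le> M"
    using G(2) by eventually_elim (use assms(2) in blast)
  with G(1,3) show ?thesis unfolding has_bai_in_def by blast
qed

subsection \<open>Directed unions\<close>

text \<open>With h = x/2 and k = y/2, the powers of 1 - (h + k - hk) = (1 - h)(1 - k) are dominated by
  those of 1 - h, which tend to 0 on xA.\<close>

lemma closedEA_subset_quasi_product: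
  assumes x: "x \<in> frakF cs" and y: "y \<in> frakF cs"
  defines "w \<equiv> (1/2) *\<^sub>R x + (1/2) *\<^sub>R y - ((1/2) *\<^sub>R x) * ((1/2) *\<^sub>R y)"
  shows "closedEA cs {x} \<subseteq> closedEA cs {w}"
proof (rule closedEA_least[OF complex_subspace_closedEA closed_closedEA])
  fix x' a
  assume "x' \<in> {x}"
  define h k where "h = (1/2) *\<^sub>R x" and "k = (1/2) *\<^sub>R y"
  \<comment> \<open>\<open>quasi_power k n\<close> lies in F and the iterate is multiplication by 1
    - \<open>quasi_power k n\<close>, hence a contraction.\<close>
  have k: "norm (((\<lambda>z. z - k * z) ^^ n) c) \<le> norm c" for n c
    using frakF_contraction[OF frakF_quasi_power[OF frakF_half[OF y]], of c n]
    by (simp only: quasi_power_diff k_def)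
  have le: "norm (x * a - quasi_power w n * (x * a)) \<le> norm (((\<lambda>z. z - h * z) ^^ n) (x * a))" for n
    unfolding quasi_power_diff w_def h_def[symmetric] k_def[symmetric] funpow_quasi_product by (rule k)
  have "(\<lambda>n. norm (((\<lambda>z. z - h * z) ^^ n) (x * a))) \<longlonglongrightarrow> 0"
    unfolding h_def by (rule tendsto_norm_zero[OF frakF_half_power_tendsto_zero[OF x]])
  then have "(\<lambda>n. x * a - quasi_power w n * (x * a)) \<longlonglongrightarrow> 0"
    by (rule Lim_null_comparison[OF always_eventually[OF allI[OF le]]])
  then have "(\<lambda>n. x * a - (x * a - quasi_power w n * (x * a))) \<longlonglongrightarrow> x * a - 0"
    by (intro tendsto_diff tendsto_const)
  then have lim: "(\<lambda>n. quasi_power w n * (x * a)) \<longlonglongrightarrow> x * a" by simp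
  have mem: "quasi_power w n * (x * a) \<in> closedEA cs {w}" for n
    using ideal_quasi_power[OF is_ideal_closedEA] subset_closedEA[of "{w}"] is_ideal_closedEA[of "{w}"]
    unfolding is_ideal_def by blast
  have "x * a \<in> closedEA cs {w}"
    by (rule closed_sequentially[OF closed_closedEA mem lim])
  with \<open>x' \<in> {x}\<close> show "x' * a \<in> closedEA cs {w}" by simp
qed

text \<open>The family consists of the ideals generated by all elements of
  \<open>J \<inter> frakF cs\<close>; quasi-products of halves make it directed. A member
  \<open>e\<close> of the approximate identity lies only in r, but its closed ideal is also
  generated by some \<open>y\<close> in F, so \<open>e * a\<close> belongs to the union and tends to
  \<open>a\<close>.\<close>

lemma directed_union_form_of_bai:
  assumes J: "closed J" "is_ideal cs J" and bai: "has_bai_in J (frakr cs)"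
  shows "directed_union_form cs (frakF cs) J"
proof -
  define \<J> where "\<J> = (\<lambda>x. closedEA cs {x}) ` (J \<inter> frakF cs)"
  have sub: "closedEA cs {x} \<subseteq> J" if "x \<in> J" for x
    using J that by (intro closedEA_least) (auto simp: is_ideal_iff)
  have "0 \<in> J" using J by (simp add: is_ideal_def)
  then have ne: "\<J> \<noteq> {}" using zero_in_frakF by (auto simp: \<J>_def)
  have gen: "\<exists>x\<in>frakF cs. I = closedEA cs {x}" if "I \<in> \<J>" for I
    using that by (auto simp: \<J>_def)
  have dir: "\<exists>I3\<in>\<J>. I1 \<union> I2 \<subseteq> I3" if I: "I1 \<in> \<J>" "I2 \<in> \<J>" for I1 I2
  proof -
    from I obtain x y where x: "x \<in> J" "x \<in> frakF cs" "I1 = closedEA cs {x}"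
      and y: "y \<in> J" "y \<in> frakF cs" "I2 = closedEA cs {y}"
      by (auto simp: \<J>_def)
    define w where "w = (1/2) *\<^sub>R x + (1/2) *\<^sub>R y - ((1/2) *\<^sub>R x) * ((1/2) *\<^sub>R y)"
    have "w \<in> J \<inter> frakF cs"
      unfolding w_def using x y J
      by (intro IntI ideal_quasi_product frakF_quasi_product ideal_scaleR frakF_half) auto
    moreover have "I1 \<subseteq> closedEA cs {w}"
      using closedEA_subset_quasi_product[OF x(2) y(2)] by (simp add: x w_def)
    \<comment> \<open>By commutativity \<open>w\<close> is symmetric in \<open>x\<close> and
      \<open>y\<close>.\<close>
    moreover have "I2 \<subseteq> closedEA cs {w}"
      using closedEA_subset_quasi_product[OF y(2) x(2)]
      unfolding y w_def by (simp only: add.commute mult.commute)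
    ultimately show ?thesis by (auto simp: \<J>_def)
  qed
  have eq: "J = closure (\<Union>\<J>)"
  proof
    show "closure (\<Union>\<J>) \<subseteq> J"
      using J(1) sub by (intro closure_minimal) (auto simp: \<J>_def)
    show "J \<subseteq> closure (\<Union>\<J>)"
    proof
      fix a
      assume a: "a \<in> J"
      obtain G M where G: "G \<noteq> bot" "\<forall>\<^sub>F e in G. e \<in> J \<and> e \<in> frakr cs \<and> norm e \<le> M"
        "((\<lambda>e. e * a) \<longlongrightarrow> a) G"
        using bai a unfolding has_bai_in_def by blast
      have "\<forall>\<^sub>F e in G. e * a \<in> closure (\<Union>\<J>)"
        using G(2)
      proof eventually_elim
        case (elim e)
        then obtain y where y: "y \<in> frakF cs" "range (\<lambda>a. y * a) = range (\<lambda>a. e * a)"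
          using frakr_same_range_frakF by blast
        have eq: "closedEA cs {y} = closedEA cs {e}"
          by (rule closedEA_eqI[OF y(2)])
        with sub[of e] elim subset_closedEA[of "{y}"] have "y \<in> J" by auto
        with y(1) have "closedEA cs {y} \<in> \<J>" by (auto simp: \<J>_def)
        moreover have "e * a \<in> closedEA cs {y}"
          unfolding eq by (simp add: mult_in_closedEA)
        ultimately show ?case
          using closure_subset[of "\<Union>\<J>"] by blast
      qed
      then show "a \<in> closure (\<Union>\<J>)"
        using Lim_in_closed_set[OF closed_closure _ G(1,3)] by blast
    qed
  qed
  show ?thesis
    unfolding directed_union_form_def
    by (intro exI[of _ \<J>] conjI ballI ne eq) (erule gen, erule (1) dir)
qed

lemma directed_union_form_mono:
  assumes "directed_union_form cs S J" and "S \<subseteq> S'"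
  shows "directed_union_form cs S' J"
proof -
  obtain \<J> where "\<J> \<noteq> {}" and gen: "\<forall>I\<in>\<J>. \<exists>x\<in>S. I = closedEA cs {x}"
    and "\<forall>I1\<in>\<J>. \<forall>I2\<in>\<J>. \<exists>I3\<in>\<J>. I1 \<union> I2 \<subseteq> I3" and "J = closure (\<Union>\<J>)"
    using assms(1) unfolding directed_union_form_def by (elim exE conjE)
  moreover have "\<forall>I\<in>\<J>. \<exists>x\<in>S'. I = closedEA cs {x}"
    using gen assms(2) by blast
  ultimately show ?thesis
    unfolding directed_union_form_def by (intro exI[of _ \<J>] conjI)
qed

text \<open>Directedness makes the union of the family a subspace, so its closure is a closed
  subspace containing the products from \<open>E\<close>. Conversely each member of the family has a
  generator in \<open>E\<close>.\<close>

lemma directed_union_form_imp_closedEA: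
  assumes "directed_union_form cs S J"
  shows "\<exists>E\<subseteq>S. J = closedEA cs E"
proof -
  obtain \<J> where ne: "\<J> \<noteq> {}" and gen: "\<And>I. I \<in> \<J> \<Longrightarrow> \<exists>x\<in>S. I = closedEA cs {x}"
    and dir: "\<And>I1 I2. I1 \<in> \<J> \<Longrightarrow> I2 \<in> \<J> \<Longrightarrow> \<exists>I3\<in>\<J>. I1 \<union> I2 \<subseteq> I3"
    and J: "J = closure (\<Union>\<J>)"
    using assms unfolding directed_union_form_def by (elim exE conjE) metis
  define E where "E = {x \<in> S. closedEA cs {x} \<in> \<J>}"
  have "complex_subspace cs (\<Union>\<J>)"
  proof -
    have sub: "complex_subspace cs I" if "I \<in> \<J>" for I
      using gen[OF that] complex_subspace_closedEA by blast
    show ?thesis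
      unfolding complex_subspace_def
    proof (intro conjI ballI allI)
      show "0 \<in> \<Union>\<J>" using ne sub by (auto simp: complex_subspace_def)
      show "cs c a \<in> \<Union>\<J>" if "a \<in> \<Union>\<J>" for c a
        using that sub unfolding complex_subspace_def by blast
      show "a + b \<in> \<Union>\<J>" if ab: "a \<in> \<Union>\<J>" "b \<in> \<Union>\<J>" for a b
      proof -
        from ab obtain I where "I \<in> \<J>" "a \<in> I" "b \<in> I"
          using dir by (meson UnCI UnionE subsetD)
        then show ?thesis using sub[of I] by (auto simp: complex_subspace_def)
      qed
    qed
  qed
  then have "closedEA cs E \<subseteq> closure (\<Union>\<J>)"
  proof (rule closedEA_least[OF complex_subspace_closure closed_closure])
    fix x a
    assume "x \<in> E"
    then have "x * a \<in> \<Union>\<J>"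
      using mult_in_closedEA[of x "{x}" a] by (auto simp: E_def)
    then show "x * a \<in> closure (\<Union>\<J>)"
      by (rule subsetD[OF closure_subset])
  qed
  moreover have "I \<subseteq> closedEA cs E" if I: "I \<in> \<J>" for I
  proof -
    obtain x where x: "x \<in> S" "I = closedEA cs {x}" using gen[OF I] by blast
    with I have "{x} \<subseteq> E" by (simp add: E_def)
    with x show ?thesis using closedEA_mono by blast
  qed
  then have "closure (\<Union>\<J>) \<subseteq> closedEA cs E"
    by (intro closure_minimal closed_closedEA) blast
  ultimately show ?thesis using J by (intro exI[of _ E]) (auto simp: E_def)
qed

end

theorem theorem7p1:
  fixes cs :: "complex \<Rightarrow> 'a::{real_normed_algebra,comm_ring,banach} \<Rightarrow> 'a"
  assumes "complex_scaling cs"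
    and "approx_unital TYPE('a)"
  shows "\<forall>J :: 'a set.
     ((closed J \<and> is_ideal cs J \<and> has_bai_in J (frakr cs)) \<longleftrightarrow>
        (\<exists>E. E \<subseteq> frakF cs \<and> J = closedEA cs E)) \<and>
     ((closed J \<and> is_ideal cs J \<and> has_bai_in J (frakr cs)) \<longleftrightarrow>
        directed_union_form cs (frakF cs) J) \<and>
     ((closed J \<and> is_ideal cs J \<and> has_bai_in J (frakF cs)) \<longleftrightarrow>
        (\<exists>E. E \<subseteq> frakr cs \<and> J = closedEA cs E)) \<and>
     ((closed J \<and> is_ideal cs J \<and> has_bai_in J (frakF cs)) \<longleftrightarrow>
        directed_union_form cs (frakr cs) J)"
proof
  fix J :: "'a set"
  interpret comm_approx_unital_algebra cs
    using assms by unfold_locales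
  let ?bai = "\<lambda>S. closed J \<and> is_ideal cs J \<and> has_bai_in J S"
  let ?gen = "\<lambda>S. \<exists>E. E \<subseteq> S \<and> J = closedEA cs E"
  \<comment> \<open>The six conditions are linked in one cycle: bai in F, bai in r, directed union
    over F, directed union over r, generation by a subset of r, generation by a subset of F, and
    back to bai in F. All the stated equivalences follow from it.\<close>
  have "?bai (frakF cs) \<Longrightarrow> ?bai (frakr cs)"
    using has_bai_in_mono frakF_subset_frakr by blast
  moreover have "?bai (frakr cs) \<Longrightarrow> directed_union_form cs (frakF cs) J"
    using directed_union_form_of_bai by blast
  moreover have "directed_union_form cs (frakF cs) J \<Longrightarrow> directed_union_form cs (frakr cs) J"
    using directed_union_form_mono frakF_subset_frakr by blast
  moreover have "directed_union_form cs (frakr cs) J \<Longrightarrow> ?gen (frakr cs)"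
    using directed_union_form_imp_closedEA by blast
  moreover have "?gen (frakr cs) \<Longrightarrow> ?gen (frakF cs)"
    using closedEA_frakr_frakF by metis
  moreover have "?gen (frakF cs) \<Longrightarrow> ?bai (frakF cs)"
    using closed_closedEA is_ideal_closedEA has_bai_in_closedEA by blast
  ultimately show "(?bai (frakr cs) \<longleftrightarrow> ?gen (frakF cs)) \<and>
      (?bai (frakr cs) \<longleftrightarrow> directed_union_form cs (frakF cs) J) \<and>
      (?bai (frakF cs) \<longleftrightarrow> ?gen (frakr cs)) \<and>
      (?bai (frakF cs) \<longleftrightarrow> directed_union_form cs (frakr cs) J)"
    by argo
qed

end
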